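(* Let $G=(V,E)$ be a finite graph and let $\gamma(G)$ denote its domination number. Then the vertex set $V$ can be partitioned into $\gamma(G)$ pairwise disjoint vertex subsets $S_1, S_2, \ldots, S_{\gamma(G)}$ such that each $S_i$ ($1 \leq i \leq \gamma(G)$) contains a vertex from a minimum dominating set in $G$ and is not outer-dominated.
   Context: A set $D \subseteq V$ is a dominating set of $G$ if every vertex of $V \setminus D$ is adjacent to at least one vertex of $D$; a minimum dominating set is a dominating set of smallest cardinality, and the domination number $\gamma(G)$ is that smallest cardinality. A vertex subset $S \subseteq V$ is called outer-dominated if there exists a vertex $u \notin S$ such that $u$ is adjacent to every vertex of $S$. *)

theory Defs
  imports "Graph_Theory.Digraph" "HOL-Library.Disjoint_Sets"
begin

text \<open>
  Undirected graphs are symmetric digraphs: under the locale predicate \<^const>\<open>graph\<close>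
  (finite, no loops, no multiple arcs, symmetric), \<open>u \<rightarrow>\<^bsub>G\<^esub> v\<close> is adjacency.
  It comes from the digraph library, where it is called \<open>dominates\<close>; this is unrelated
  to the vertex-set notions below.
\<close>

definition dominating_set :: "('a, 'b) pre_digraph \<Rightarrow> 'a set \<Rightarrow> bool" where
  "dominating_set G D \<longleftrightarrow>
     D \<subseteq> verts G \<and> (\<forall>v \<in> verts G - D. \<exists>d \<in> D. v \<rightarrow>\<^bsub>G\<^esub> d)"

definition minimum_dominating_set :: "('a, 'b) pre_digraph \<Rightarrow> 'a set \<Rightarrow> bool" where
  "minimum_dominating_set G D \<longleftrightarrow> is_arg_min card (dominating_set G) D"

definition domination_number :: "('a, 'b) pre_digraph \<Rightarrow> nat" where
  "domination_number G = (LEAST k. \<exists>D. dominating_set G D \<and> card D = k)"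

definition outer_dominated :: "('a, 'b) pre_digraph \<Rightarrow> 'a set \<Rightarrow> bool" where
  "outer_dominated G S \<longleftrightarrow>
     S \<subseteq> verts G \<and> (\<exists>u \<in> verts G - S. \<forall>v \<in> S. u \<rightarrow>\<^bsub>G\<^esub> v)"

end

theory Submission
  imports Defs
begin

text \<open>
  This is the argument of Jaeger and Payan. Assign every vertex to itself or a neighbour in a
  fixed minimum dominating set \<open>D\<close>, fixing \<open>D\<close> pointwise, such that the number of vertices
  adjacent to all other vertices of their own class is as large as possible. Suppose \<open>x\<close> lies
  outside the class of \<open>d\<close> and is adjacent to all of it. If \<open>x\<close> is also adjacent to the rest of
  its own class, then \<open>x\<close> can replace \<open>d\<close> and the centre of that class in \<open>D\<close>, contradicting
  minimality. Otherwise moving \<open>x\<close> into the class of \<open>d\<close> increases the count.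
\<close>

text \<open>The classes are the fibres of \<open>f\<close>, indexed by their centres in
  \<open>D\<close>. Fixing \<open>D\<close> pointwise puts each centre into its own class, so every
  class meets \<open>D\<close>.\<close>

definition dom_assignment :: "('a, 'b) pre_digraph \<Rightarrow> 'a set \<Rightarrow> ('a \<Rightarrow> 'a) \<Rightarrow> bool" where
  "dom_assignment G D f \<longleftrightarrow>
     (\<forall>d\<in>D. f d = d) \<and> (\<forall>v\<in>verts G. f v \<in> D \<and> (v = f v \<or> v \<rightarrow>\<^bsub>G\<^esub> f v))"

definition class_universal :: "('a, 'b) pre_digraph \<Rightarrow> ('a \<Rightarrow> 'a) \<Rightarrow> 'a set" where
  "class_universal G f =
     {v \<in> verts G. \<forall>w\<in>verts G. f w = f v \<longrightarrow> w \<noteq> v \<longrightarrow> v \<rightarrow>\<^bsub>G\<^esub> w}"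

lemma dominating_set_verts: "dominating_set G (verts G)"
  by (simp add: dominating_set_def)

lemma minimum_dominating_set_exists: "\<exists>D. minimum_dominating_set G D"
  unfolding minimum_dominating_set_def
  by (metis arg_min_nat_lemma dominating_set_verts is_arg_min_linorder)

lemma card_minimum_dominating_set:
  assumes "minimum_dominating_set G D"
  shows "card D = domination_number G"
  unfolding domination_number_def
  by (rule Least_equality[symmetric])
    (use assms in \<open>auto simp: minimum_dominating_set_def is_arg_min_linorder\<close>)

lemma dom_assignment_exists:
  assumes "dominating_set G D"
  shows "\<exists>f. dom_assignment G D f"
proof -
  \<comment> \<open>The implication forces the choice \<open>d = v\<close> for \<open>v\<close> in
    \<open>D\<close>, so that the resulting function fixes \<open>D\<close>.\<close>
  have "\<forall>v\<in>verts G. \<exists>d\<in>D. (v \<in> D \<longrightarrow> d = v) \<and> (v = d \<or> v \<rightarrow>\<^bsub>G\<^esub> d)"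
    using assms unfolding dominating_set_def by blast
  then obtain f where "\<forall>v\<in>verts G. f v \<in> D \<and> (v \<in> D \<longrightarrow> f v = v) \<and> (v = f v \<or> v \<rightarrow>\<^bsub>G\<^esub> f v)"
    by metis
  then have "dom_assignment G D f"
    using assms unfolding dom_assignment_def dominating_set_def by blast
  then show ?thesis
    by blast
qed

text \<open>Apart from \<open>x\<close>, all vertices in the classes of \<open>d\<close> and
  \<open>f x\<close> are adjacent to \<open>x\<close>; every other vertex \<open>v\<close> keeps its
  centre \<open>f v\<close>, which survives in the new set.\<close>

lemma dominating_set_merge_classes:
  assumes "graph G" and D: "dominating_set G D" and f: "dom_assignment G D f"
    and x: "x \<in> class_universal G f"
    and adj: "\<And>w. w \<in> verts G \<Longrightarrow> f w = d \<Longrightarrow> x \<rightarrow>\<^bsub>G\<^esub> w"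
  shows "dominating_set G (insert x (D - {d, f x}))"
proof -
  interpret graph G by fact
  have "\<exists>e\<in>insert x (D - {d, f x}). v \<rightarrow>\<^bsub>G\<^esub> e"
    if v: "v \<in> verts G - insert x (D - {d, f x})" for v
  proof (cases "f v = d \<or> f v = f x")
    case True
    then have "x \<rightarrow>\<^bsub>G\<^esub> v"
      using adj x v unfolding class_universal_def by blast
    then show ?thesis
      by (blast intro: arcs_ends_symmetric[OF sym_arcs])
  next
    case False
    then have "f v \<in> D - {d, f x}" "v = f v \<or> v \<rightarrow>\<^bsub>G\<^esub> f v"
      using f v by (auto simp: dom_assignment_def)
    then show ?thesis
      using v by (intro bexI[of _ "f v"]) auto
  qed
  then show ?thesis
    using D x unfolding dominating_set_def class_universal_def by blast
qed

text \<open>In the class of \<open>d\<close>, which gains \<open>x\<close>, universal vertices stay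
  universal because adjacency to \<open>x\<close> is symmetric; other classes can only lose
  \<open>x\<close>. Strictness comes from \<open>x\<close>, which becomes universal in its new
  class.\<close>

lemma class_universal_move:
  assumes "graph G" and x: "x \<in> verts G" "x \<notin> class_universal G f"
    and adj: "\<And>w. w \<in> verts G \<Longrightarrow> f w = d \<Longrightarrow> x \<rightarrow>\<^bsub>G\<^esub> w"
  shows "class_universal G f \<subset> class_universal G (f(x := d))"
proof -
  interpret graph G by fact
  have "x \<in> class_universal G (f(x := d))"
    using x(1) adj by (auto simp: class_universal_def)
  moreover have "v \<in> class_universal G (f(x := d))" if v: "v \<in> class_universal G f" for v
  proof -
    have "v \<rightarrow>\<^bsub>G\<^esub> x" if "f v = d"
      by (rule arcs_ends_symmetric[OF sym_arcs], rule adj)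
        (use that v in \<open>auto simp: class_universal_def\<close>)
    then show ?thesis
      using v x(2) by (auto simp: class_universal_def)
  qed
  ultimately show ?thesis
    using x(2) by blast
qed

lemma exists_assignment_not_outer_dominated:
  assumes "graph G" and D: "minimum_dominating_set G D"
  shows "\<exists>f. dom_assignment G D f \<and> (\<forall>d\<in>D. \<not> outer_dominated G {v \<in> verts G. f v = d})"
proof -
  interpret graph G by fact
  have dom: "dominating_set G D" and min: "\<And>E. dominating_set G E \<Longrightarrow> card D \<le> card E"
    using D by (auto simp: minimum_dominating_set_def is_arg_min_linorder)
  have DV: "D \<subseteq> verts G"
    using dom by (simp add: dominating_set_def)
  then have finD: "finite D"
    by (rule finite_subset) simp
  obtain f0 where "dom_assignment G D f0"
    using dom_assignment_exists[OF dom] by blast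
  \<comment> \<open>A uniform bound, so that a maximising assignment exists.\<close>
  moreover have "card (class_universal G f) < Suc (card (verts G))" for f
    by (auto simp: class_universal_def less_Suc_eq_le intro: card_mono)
  ultimately obtain f where f: "dom_assignment G D f"
    and max: "\<And>g. dom_assignment G D g \<Longrightarrow>
      card (class_universal G g) \<le> card (class_universal G f)"
    using ex_has_greatest_nat[of "dom_assignment G D" f0 "\<lambda>f. card (class_universal G f)"]
    by (metis less_imp_le)
  have "\<not> outer_dominated G {v \<in> verts G. f v = d}" if d: "d \<in> D" for d
  proof
    assume "outer_dominated G {v \<in> verts G. f v = d}"
    then obtain x where x: "x \<in> verts G" "f x \<noteq> d"
      and adj: "\<And>w. w \<in> verts G \<Longrightarrow> f w = d \<Longrightarrow> x \<rightarrow>\<^bsub>G\<^esub> w"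
      unfolding outer_dominated_def by blast
    have fx: "f x \<in> D"
      using f x unfolding dom_assignment_def by blast
    have x_not: "x \<notin> class_universal G f"
    proof
      assume "x \<in> class_universal G f"
      then have "card D \<le> card (insert x (D - {d, f x}))"
        by (intro min dominating_set_merge_classes assms(1) dom f adj)
      also have "\<dots> \<le> Suc (card (D - {d, f x}))"
        by (simp add: card_insert_le_m1 card_insert_if finD)
      \<comment> \<open>Two distinct elements leave \<open>D\<close> and at most one enters. As
        subtraction truncates, the estimate only yields \<open>card D < 2\<close>, which the pair
        \<open>d\<close>, \<open>f x\<close> refutes.\<close>
      also have "card (D - {d, f x}) = card D - 2"
        using d fx x(2) finD by (subst card_Diff_subset) auto
      finally have "card D < 2"
        by simp
      moreover have "card {d, f x} \<le> card D"
        using d fx finD by (intro card_mono) auto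
      ultimately show False
        using x(2) by simp
    qed
    \<comment> \<open>Needed so that moving \<open>x\<close> keeps \<open>D\<close> fixed pointwise.
      A vertex of \<open>D\<close> is the centre of its own class, hence universal there by
      symmetry, against \<open>x_not\<close>.\<close>
    have "x \<notin> D"
    proof
      assume "x \<in> D"
      then have "f x = x"
        using f unfolding dom_assignment_def by blast
      moreover have "x \<rightarrow>\<^bsub>G\<^esub> w" if "w \<in> verts G" "f w = x" "w \<noteq> x" for w
        using f that unfolding dom_assignment_def by (metis arcs_ends_symmetric sym_arcs)
      ultimately show False
        using x_not x(1) by (auto simp: class_universal_def)
    qed
    moreover have "x \<rightarrow>\<^bsub>G\<^esub> d"
      using adj d DV f unfolding dom_assignment_def by blast
    ultimately have "dom_assignment G D (f(x := d))"
      using f d by (auto simp: dom_assignment_def)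
    moreover have "card (class_universal G f) < card (class_universal G (f(x := d)))"
      by (intro psubset_card_mono class_universal_move assms(1) x(1) x_not adj)
        (auto simp: class_universal_def)
    ultimately show False
      using max by fastforce
  qed
  then show ?thesis
    using f by blast
qed

theorem theorem1:
  fixes G :: "('a, 'b) pre_digraph"
  assumes "graph G"
  shows "\<exists>(S :: nat \<Rightarrow> 'a set) D.
           minimum_dominating_set G D \<and>
           (\<Union>i \<in> {1..domination_number G}. S i) = verts G \<and>
           disjoint_family_on S {1..domination_number G} \<and>
           (\<forall>i \<in> {1..domination_number G}. S i \<inter> D \<noteq> {} \<and> \<not> outer_dominated G (S i))"
proof -
  interpret graph G by fact
  let ?I = "{1..domination_number G}"
  obtain D where D: "minimum_dominating_set G D"
    using minimum_dominating_set_exists by blast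
  then have DV: "D \<subseteq> verts G"
    by (auto simp: minimum_dominating_set_def is_arg_min_linorder dominating_set_def)
  obtain f where f: "dom_assignment G D f"
    and nod: "\<forall>d\<in>D. \<not> outer_dominated G {v \<in> verts G. f v = d}"
    using exists_assignment_not_outer_dominated[OF assms D] by blast
  have "finite D"
    by (rule finite_subset[OF DV]) simp
  \<comment> \<open>\<open>h\<close> numbers the centres from 1, and the class of the centre
    \<open>h i\<close> serves as \<open>S i\<close>.\<close>
  then obtain h where h: "bij_betw h ?I D"
    using card_minimum_dominating_set[OF D] by (metis bij_betw_iff_card card_atLeastAtMost
        diff_Suc_1 finite_atLeastAtMost One_nat_def)
  define S where "S i = {v \<in> verts G. f v = h i}" for i
  have hI: "h ` ?I = D"
    using h by (rule bij_betw_imp_surj_on)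
  have "(\<Union>i\<in>?I. S i) = {v \<in> verts G. f v \<in> h ` ?I}"
    by (auto simp: S_def)
  also have "\<dots> = verts G"
    using f unfolding hI dom_assignment_def by blast
  finally have "(\<Union>i\<in>?I. S i) = verts G" .
  moreover have "disjoint_family_on S ?I"
    unfolding disjoint_family_on_def
  proof (intro ballI impI)
    fix i j assume "i \<in> ?I" "j \<in> ?I" "i \<noteq> j"
    then have "h i \<noteq> h j"
      using bij_betw_imp_inj_on[OF h] inj_on_contraD by metis
    then show "S i \<inter> S j = {}"
      by (simp add: S_def disjoint_iff)
  qed
  moreover have "S i \<inter> D \<noteq> {} \<and> \<not> outer_dominated G (S i)" if "i \<in> ?I" for i
  proof -
    have "h i \<in> D"
      using hI that by blast
    moreover from this have "h i \<in> S i"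
      using f DV by (auto simp: S_def dom_assignment_def)
    ultimately show ?thesis
      using nod by (auto simp: S_def)
  qed
  ultimately show ?thesis
    using D by blast
qed

end
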